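(* Let $X$ be a diffeological space, $P\to X$ a principal $H_\sigma$-bundle with transition functions $h_{ij}=(g_{ij},\varepsilon_{ij}):U_{ij}\to H_\sigma=G\rtimes_\sigma\mathbb Z_2$ over a good cover $(U_i)$, and let $\alpha=[\varepsilon_{ij}]\in H^1(X;\mathbb Z_2)$. For local lifts $\widehat g_{ij}:U_{ij}\to\widehat G$ of $g_{ij}$ (i.e. $q(\widehat g_{ij})=g_{ij}$) put $a_{ijk}=\widehat g_{ij}\,\widehat\sigma^{\varepsilon_{ij}}(\widehat g_{jk})\,\widehat g_{ik}^{-1}$. Then the cohomology class $[a]\in H^2(X;A_\alpha)$ defined by $(a_{ijk})$ is independent of the choice of local lifts $\widehat g_{ij}$.
   Context: Let $1\to A\to\widehat G\xrightarrow{q}G\to1$ be a central extension of diffeological groups with $A$ abelian. Let $\sigma:\mathbb Z_2\to\operatorname{Aut}(G)$ be a smooth action ($\mathbb Z_2=\{\pm1\}$), lifting to an action $\widehat\sigma:\mathbb Z_2\to\operatorname{Aut}(\widehat G)$ with $q\circ\widehat\sigma^\varepsilon=\sigma^\varepsilon\circ q$ for all $\varepsilon$. $H_\sigma=G\rtimes_\sigma\mathbb Z_2$ has product $(g,\varepsilon)(g',\varepsilon')=(g\,\sigma^\varepsilon(g'),\varepsilon\varepsilon')$. The transition functions satisfy $h_{ij}h_{jk}=h_{ik}$ on $U_{ijk}$, i.e. $\varepsilon_{ij}\varepsilon_{jk}=\varepsilon_{ik}$ and $g_{ij}\sigma^{\varepsilon_{ij}}(g_{jk})=g_{ik}$. The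 cover is taken such that smooth lifts $\widehat g_{ij}$ exist. $A_\alpha$ is the local system with fibre $A$ obtained by gluing $U_i\times A$ along $U_{ij}$ by $\widehat\sigma^{\varepsilon_{ij}}|_A$. The family $(a_{ijk})$ takes values in $A$ and is a Čech $2$-cocycle with coefficients in $A_\alpha$, meaning $a_{ijk}a_{ikl}=\widehat\sigma^{\varepsilon_{ij}}(a_{jkl})a_{ijl}$ on $U_{ijkl}$. Two such cocycles are cohomologous when they differ by a coboundary $b_{ij}\,\widehat\sigma^{\varepsilon_{ij}}(b_{jk})\,b_{ik}^{-1}$ with $b_{ij}:U_{ij}\to A$ smooth. *)

theory Defs
  imports "HOL-Analysis.Analysis" "HOL-Algebra.Coset" "HOL-Algebra.Bij"
begin

section \<open>Smooth functions between open subsets of Euclidean spaces\<close>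

text \<open>
  The dimension has to vary inside the definition of a diffeology, so \<open>\<real>\<^sup>n\<close> is the set of
  sequences vanishing from index \<open>n\<close> on, with the library topology \<^const>\<open>Euclidean_space\<close>.
\<close>

definition partial_deriv :: "nat \<Rightarrow> ((nat \<Rightarrow> real) \<Rightarrow> real) \<Rightarrow> (nat \<Rightarrow> real) \<Rightarrow> real" where
  "partial_deriv i f x = deriv (\<lambda>t. f (x(i := t))) (x i)"

fun C_k_on :: "nat \<Rightarrow> nat \<Rightarrow> (nat \<Rightarrow> real) set \<Rightarrow> ((nat \<Rightarrow> real) \<Rightarrow> real) \<Rightarrow> bool" where
  "C_k_on n 0 U f \<longleftrightarrow>
     continuous_map (subtopology (Euclidean_space n) U) euclideanreal f"
| "C_k_on n (Suc k) U f \<longleftrightarrow>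
     continuous_map (subtopology (Euclidean_space n) U) euclideanreal f \<and>
     (\<forall>i<n. (\<forall>x\<in>U. (\<lambda>t. f (x(i := t))) differentiable (at (x i))) \<and>
            C_k_on n k U (partial_deriv i f))"

definition smooth_real_on :: "nat \<Rightarrow> (nat \<Rightarrow> real) set \<Rightarrow> ((nat \<Rightarrow> real) \<Rightarrow> real) \<Rightarrow> bool" where
  "smooth_real_on n U f \<longleftrightarrow> (\<forall>k. C_k_on n k U f)"

definition smooth_between ::
  "nat \<Rightarrow> (nat \<Rightarrow> real) set \<Rightarrow> nat \<Rightarrow> (nat \<Rightarrow> real) set \<Rightarrow>
   ((nat \<Rightarrow> real) \<Rightarrow> nat \<Rightarrow> real) \<Rightarrow> bool" where
  "smooth_between m V n U F \<longleftrightarrow>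
     F ` V \<subseteq> U \<and> (\<forall>i<n. smooth_real_on m V (\<lambda>v. F v i))"

section \<open>Diffeological spaces\<close>

text \<open>
  \<open>plot D n U p\<close> says that the restriction of \<open>p\<close> to the open set \<open>U \<subseteq> \<real>\<^sup>n\<close> is a plot of \<open>D\<close>;
  the values of \<open>p\<close> outside \<open>U\<close> are irrelevant by \<open>plot_cong\<close> below.
\<close>

record 'a diff_space =
  points :: "'a set"
  plot :: "nat \<Rightarrow> (nat \<Rightarrow> real) set \<Rightarrow> ((nat \<Rightarrow> real) \<Rightarrow> 'a) \<Rightarrow> bool"

locale diffeological_space =
  fixes D :: "'a diff_space"
  assumes plot_dom: "plot D n U p \<Longrightarrow> openin (Euclidean_space n) U"
    and plot_val: "plot D n U p \<Longrightarrow> p ` U \<subseteq> points D"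
    and plot_cong: "\<lbrakk>plot D n U p; \<And>u. u \<in> U \<Longrightarrow> p u = p' u\<rbrakk> \<Longrightarrow> plot D n U p'"
    and plot_const:
      "\<lbrakk>openin (Euclidean_space n) U; x \<in> points D\<rbrakk> \<Longrightarrow> plot D n U (\<lambda>_. x)"
    and plot_local:
      "\<lbrakk>openin (Euclidean_space n) U;
        \<And>u. u \<in> U \<Longrightarrow> \<exists>V. u \<in> V \<and> V \<subseteq> U \<and> plot D n V p\<rbrakk> \<Longrightarrow> plot D n U p"
    and plot_compose:
      "\<lbrakk>plot D n U p; openin (Euclidean_space m) V; smooth_between m V n U F\<rbrakk>
       \<Longrightarrow> plot D m V (p \<circ> F)"

definition smooth_map :: "'a diff_space \<Rightarrow> 'b diff_space \<Rightarrow> ('a \<Rightarrow> 'b) \<Rightarrow> bool" where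
  "smooth_map D E f \<longleftrightarrow>
     f ` points D \<subseteq> points E \<and> (\<forall>n U p. plot D n U p \<longrightarrow> plot E n U (f \<circ> p))"

definition diffeomorphism :: "'a diff_space \<Rightarrow> 'b diff_space \<Rightarrow> ('a \<Rightarrow> 'b) \<Rightarrow> bool" where
  "diffeomorphism D E f \<longleftrightarrow>
     bij_betw f (points D) (points E) \<and> smooth_map D E f \<and>
     smooth_map E D (inv_into (points D) f)"

definition induction_map :: "'a diff_space \<Rightarrow> 'b diff_space \<Rightarrow> ('a \<Rightarrow> 'b) \<Rightarrow> bool" where
  "induction_map D E f \<longleftrightarrow>
     smooth_map D E f \<and> inj_on f (points D) \<and>
     (\<forall>n U p. p ` U \<subseteq> points D \<and> plot E n U (f \<circ> p) \<longrightarrow> plot D n U p)"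

definition subduction_map :: "'a diff_space \<Rightarrow> 'b diff_space \<Rightarrow> ('a \<Rightarrow> 'b) \<Rightarrow> bool" where
  "subduction_map D E f \<longleftrightarrow>
     smooth_map D E f \<and> f ` points D = points E \<and>
     (\<forall>n U p. plot E n U p \<longrightarrow>
        (\<forall>u\<in>U. \<exists>V r. u \<in> V \<and> V \<subseteq> U \<and> plot D n V r \<and> (\<forall>v\<in>V. f (r v) = p v)))"

definition subset_space :: "'a diff_space \<Rightarrow> 'a set \<Rightarrow> 'a diff_space" where
  "subset_space D S =
     \<lparr>points = points D \<inter> S, plot = (\<lambda>n U p. plot D n U p \<and> p ` U \<subseteq> S)\<rparr>"

definition product_space :: "'a diff_space \<Rightarrow> 'b diff_space \<Rightarrow> ('a \<times> 'b) diff_space" where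
  "product_space D E =
     \<lparr>points = points D \<times> points E,
      plot = (\<lambda>n U p. plot D n U (fst \<circ> p) \<and> plot E n U (snd \<circ> p))\<rparr>"

definition discrete_space :: "'a set \<Rightarrow> 'a diff_space" where
  "discrete_space S =
     \<lparr>points = S,
      plot = (\<lambda>n U p. openin (Euclidean_space n) U \<and> p ` U \<subseteq> S \<and>
        (\<forall>u\<in>U. \<exists>V. openin (Euclidean_space n) V \<and> u \<in> V \<and> V \<subseteq> U \<and> (\<forall>v\<in>V. p v = p u)))\<rparr>"

definition real_space :: "real diff_space" where
  "real_space =
     \<lparr>points = UNIV,
      plot = (\<lambda>n U p. openin (Euclidean_space n) U \<and> smooth_real_on n U p)\<rparr>"

definition D_open :: "'a diff_space \<Rightarrow> 'a set \<Rightarrow> bool" where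
  "D_open D W \<longleftrightarrow>
     W \<subseteq> points D \<and>
     (\<forall>n U p. plot D n U p \<longrightarrow> openin (Euclidean_space n) {u \<in> U. p u \<in> W})"

text \<open>Smooth homotopies are parametrised by \<open>\<real>\<close>, as usual in diffeology.\<close>

definition smoothly_contractible :: "'a diff_space \<Rightarrow> bool" where
  "smoothly_contractible D \<longleftrightarrow>
     (\<exists>c\<in>points D. \<exists>H. smooth_map (product_space real_space D) D H \<and>
        (\<forall>x\<in>points D. H (0, x) = x \<and> H (1, x) = c))"

definition good_cover :: "'x diff_space \<Rightarrow> 'i set \<Rightarrow> ('i \<Rightarrow> 'x set) \<Rightarrow> bool" where
  "good_cover X I U \<longleftrightarrow>
     (\<forall>i\<in>I. D_open X (U i)) \<and> (\<Union>i\<in>I. U i) = points X \<and>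
     (\<forall>F. finite F \<and> F \<noteq> {} \<and> F \<subseteq> I \<and> (\<Inter>i\<in>F. U i) \<noteq> {} \<longrightarrow>
        smoothly_contractible (subset_space X (\<Inter>i\<in>F. U i)))"

section \<open>Diffeological groups\<close>

locale diffeological_group = group G + diffeological_space D
  for G :: "('g, 'm) monoid_scheme" (structure) and D :: "'g diff_space" +
  assumes points_carrier: "points D = carrier G"
    and smooth_mult: "smooth_map (product_space D D) D (\<lambda>(x, y). x \<otimes> y)"
    and smooth_inv: "smooth_map D D (\<lambda>x. inv x)"

definition sign_group :: "int monoid" where
  "sign_group = \<lparr>carrier = {1, -1}, mult = (*), one = 1\<rparr>"

definition sign_space :: "int diff_space" where
  "sign_space = discrete_space {1, -1}"

definition smooth_sign_action ::
  "('g, 'm) monoid_scheme \<Rightarrow> 'g diff_space \<Rightarrow> (int \<Rightarrow> 'g \<Rightarrow> 'g) \<Rightarrow> bool" where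
  "smooth_sign_action G D \<sigma> \<longleftrightarrow>
     \<sigma> \<in> hom sign_group (AutoGroup G) \<and>
     smooth_map (product_space sign_space D) D (\<lambda>(\<epsilon>, g). \<sigma> \<epsilon> g)"

definition semidirect_sign ::
  "('g, 'm) monoid_scheme \<Rightarrow> (int \<Rightarrow> 'g \<Rightarrow> 'g) \<Rightarrow> ('g \<times> int) monoid" where
  "semidirect_sign G \<sigma> =
     \<lparr>carrier = carrier G \<times> carrier sign_group,
      mult = (\<lambda>(g, \<epsilon>) (g', \<epsilon>'). (g \<otimes>\<^bsub>G\<^esub> \<sigma> \<epsilon> g', \<epsilon> * \<epsilon>')),
      one = (\<one>\<^bsub>G\<^esub>, 1)\<rparr>"

definition semidirect_sign_space :: "'g diff_space \<Rightarrow> ('g \<times> int) diff_space" where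
  "semidirect_sign_space D = product_space D sign_space"

text \<open>
  Exactness is meant in the category of diffeological groups: besides exactness of the underlying
  groups, \<open>\<iota>\<close> is an induction (so \<open>A\<close> carries the subset diffeology of the kernel of \<open>q\<close>) and
  \<open>q\<close> is a subduction.
\<close>

definition central_extension ::
  "('a, 'k) monoid_scheme \<Rightarrow> 'a diff_space \<Rightarrow> ('h, 'l) monoid_scheme \<Rightarrow> 'h diff_space \<Rightarrow>
   ('g, 'm) monoid_scheme \<Rightarrow> 'g diff_space \<Rightarrow> ('a \<Rightarrow> 'h) \<Rightarrow> ('h \<Rightarrow> 'g) \<Rightarrow> bool" where
  "central_extension A DA Gh DGh G DG \<iota> q \<longleftrightarrow>
     comm_group A \<and> diffeological_group A DA \<and>
     diffeological_group Gh DGh \<and> diffeological_group G DG \<and>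
     \<iota> \<in> hom A Gh \<and> q \<in> hom Gh G \<and>
     induction_map DA DGh \<iota> \<and> subduction_map DGh DG q \<and>
     \<iota> ` carrier A = Coset.kernel Gh G q \<and>
     (\<forall>a\<in>carrier A. \<forall>x\<in>carrier Gh. \<iota> a \<otimes>\<^bsub>Gh\<^esub> x = x \<otimes>\<^bsub>Gh\<^esub> \<iota> a)"

text \<open>The automorphism of \<open>A\<close> obtained by restricting an automorphism of the extension.\<close>

definition restrict_to ::
  "('a, 'k) monoid_scheme \<Rightarrow> ('a \<Rightarrow> 'h) \<Rightarrow> (int \<Rightarrow> 'h \<Rightarrow> 'h) \<Rightarrow> int \<Rightarrow> 'a \<Rightarrow> 'a" where
  "restrict_to A \<iota> \<sigma> \<epsilon> a = inv_into (carrier A) \<iota> (\<sigma> \<epsilon> (\<iota> a))"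

section \<open>Principal bundles and transition functions\<close>

definition smooth_right_action ::
  "'p diff_space \<Rightarrow> ('s, 'm) monoid_scheme \<Rightarrow> 's diff_space \<Rightarrow> ('p \<Rightarrow> 's \<Rightarrow> 'p) \<Rightarrow> bool" where
  "smooth_right_action P S DS act \<longleftrightarrow>
     smooth_map (product_space P DS) P (\<lambda>(p, s). act p s) \<and>
     (\<forall>p\<in>points P. act p \<one>\<^bsub>S\<^esub> = p) \<and>
     (\<forall>p\<in>points P. \<forall>s\<in>carrier S. \<forall>t\<in>carrier S. act (act p s) t = act p (s \<otimes>\<^bsub>S\<^esub> t))"

definition local_trivialisation ::
  "'x diff_space \<Rightarrow> ('s, 'm) monoid_scheme \<Rightarrow> 's diff_space \<Rightarrow> 'p diff_space \<Rightarrow>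
   ('p \<Rightarrow> 'x) \<Rightarrow> ('p \<Rightarrow> 's \<Rightarrow> 'p) \<Rightarrow> 'x set \<Rightarrow> ('x \<times> 's \<Rightarrow> 'p) \<Rightarrow> bool" where
  "local_trivialisation X S DS P \<pi> act W \<phi> \<longleftrightarrow>
     diffeomorphism (product_space (subset_space X W) DS) (subset_space P {p. \<pi> p \<in> W}) \<phi> \<and>
     (\<forall>x\<in>W. \<forall>s\<in>carrier S. \<pi> (\<phi> (x, s)) = x) \<and>
     (\<forall>x\<in>W. \<forall>s\<in>carrier S. \<forall>t\<in>carrier S. act (\<phi> (x, s)) t = \<phi> (x, s \<otimes>\<^bsub>S\<^esub> t))"

definition principal_bundle ::
  "'x diff_space \<Rightarrow> ('s, 'm) monoid_scheme \<Rightarrow> 's diff_space \<Rightarrow> 'p diff_space \<Rightarrow>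
   ('p \<Rightarrow> 'x) \<Rightarrow> ('p \<Rightarrow> 's \<Rightarrow> 'p) \<Rightarrow> bool" where
  "principal_bundle X S DS P \<pi> act \<longleftrightarrow>
     diffeological_space X \<and> diffeological_space P \<and> diffeological_group S DS \<and>
     smooth_map P X \<pi> \<and> smooth_right_action P S DS act \<and>
     (\<forall>x\<in>points X. \<exists>W \<phi>. x \<in> W \<and> D_open X W \<and> local_trivialisation X S DS P \<pi> act W \<phi>)"

text \<open>
  The convention \<open>\<phi>\<^sub>j(x, s) = \<phi>\<^sub>i(x, h\<^sub>i\<^sub>j(x) s)\<close> is the one that gives
  \<open>h\<^sub>i\<^sub>j h\<^sub>j\<^sub>k = h\<^sub>i\<^sub>k\<close>.
\<close>

definition transition_functions ::
  "'x diff_space \<Rightarrow> ('s, 'm) monoid_scheme \<Rightarrow> 's diff_space \<Rightarrow> 'p diff_space \<Rightarrow>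
   ('p \<Rightarrow> 'x) \<Rightarrow> ('p \<Rightarrow> 's \<Rightarrow> 'p) \<Rightarrow> 'i set \<Rightarrow> ('i \<Rightarrow> 'x set) \<Rightarrow>
   ('i \<Rightarrow> 'i \<Rightarrow> 'x \<Rightarrow> 's) \<Rightarrow> bool" where
  "transition_functions X S DS P \<pi> act I U h \<longleftrightarrow>
     (\<forall>i\<in>I. \<forall>j\<in>I. smooth_map (subset_space X (U i \<inter> U j)) DS (h i j)) \<and>
     (\<exists>\<phi>. (\<forall>i\<in>I. local_trivialisation X S DS P \<pi> act (U i) (\<phi> i)) \<and>
          (\<forall>i\<in>I. \<forall>j\<in>I. \<forall>x\<in>U i \<inter> U j. \<forall>s\<in>carrier S.
             \<phi> j (x, s) = \<phi> i (x, h i j x \<otimes>\<^bsub>S\<^esub> s)))"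

section \<open>Cech cohomology with coefficients in the local system\<close>

text \<open>
  A section of the local system over \<open>U\<^sub>i\<^sub>j\<^sub>k\<close> is written in the trivialisation over \<open>U\<^sub>i\<close> given by the
  first index; \<open>\<tau>\<close> is the action of the signs on \<open>A\<close> and \<open>e\<^sub>i\<^sub>j\<close> the cocycle of signs that glues the
  pieces \<open>U\<^sub>i \<times> A\<close>. Cochains are total functions, of which only the values at indices in \<open>I\<close> and
  points of the respective intersection matter.
\<close>

definition twisted_cocycles ::
  "'x diff_space \<Rightarrow> 'i set \<Rightarrow> ('i \<Rightarrow> 'x set) \<Rightarrow> ('a, 'k) monoid_scheme \<Rightarrow> 'a diff_space \<Rightarrow>
   (int \<Rightarrow> 'a \<Rightarrow> 'a) \<Rightarrow> ('i \<Rightarrow> 'i \<Rightarrow> 'x \<Rightarrow> int) \<Rightarrow> ('i \<Rightarrow> 'i \<Rightarrow> 'i \<Rightarrow> 'x \<Rightarrow> 'a) set" where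
  "twisted_cocycles X I U A DA \<tau> e =
     {a. (\<forall>i\<in>I. \<forall>j\<in>I. \<forall>k\<in>I. smooth_map (subset_space X (U i \<inter> U j \<inter> U k)) DA (a i j k)) \<and>
         (\<forall>i\<in>I. \<forall>j\<in>I. \<forall>k\<in>I. \<forall>l\<in>I. \<forall>x\<in>U i \<inter> U j \<inter> U k \<inter> U l.
            a i j k x \<otimes>\<^bsub>A\<^esub> a i k l x = \<tau> (e i j x) (a j k l x) \<otimes>\<^bsub>A\<^esub> a i j l x)}"

definition cohomologous ::
  "'x diff_space \<Rightarrow> 'i set \<Rightarrow> ('i \<Rightarrow> 'x set) \<Rightarrow> ('a, 'k) monoid_scheme \<Rightarrow> 'a diff_space \<Rightarrow>
   (int \<Rightarrow> 'a \<Rightarrow> 'a) \<Rightarrow> ('i \<Rightarrow> 'i \<Rightarrow> 'x \<Rightarrow> int) \<Rightarrow>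
   (('i \<Rightarrow> 'i \<Rightarrow> 'i \<Rightarrow> 'x \<Rightarrow> 'a) \<times> ('i \<Rightarrow> 'i \<Rightarrow> 'i \<Rightarrow> 'x \<Rightarrow> 'a)) set" where
  "cohomologous X I U A DA \<tau> e =
     {(a, a'). a \<in> twisted_cocycles X I U A DA \<tau> e \<and> a' \<in> twisted_cocycles X I U A DA \<tau> e \<and>
        (\<exists>b. (\<forall>i\<in>I. \<forall>j\<in>I. smooth_map (subset_space X (U i \<inter> U j)) DA (b i j)) \<and>
             (\<forall>i\<in>I. \<forall>j\<in>I. \<forall>k\<in>I. \<forall>x\<in>U i \<inter> U j \<inter> U k.
                a' i j k x = a i j k x \<otimes>\<^bsub>A\<^esub>
                  (b i j x \<otimes>\<^bsub>A\<^esub> \<tau> (e i j x) (b j k x) \<otimes>\<^bsub>A\<^esub> inv\<^bsub>A\<^esub> (b i k x))))}"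

definition twisted_H2 ::
  "'x diff_space \<Rightarrow> 'i set \<Rightarrow> ('i \<Rightarrow> 'x set) \<Rightarrow> ('a, 'k) monoid_scheme \<Rightarrow> 'a diff_space \<Rightarrow>
   (int \<Rightarrow> 'a \<Rightarrow> 'a) \<Rightarrow> ('i \<Rightarrow> 'i \<Rightarrow> 'x \<Rightarrow> int) \<Rightarrow> ('i \<Rightarrow> 'i \<Rightarrow> 'i \<Rightarrow> 'x \<Rightarrow> 'a) set set" where
  "twisted_H2 X I U A DA \<tau> e =
     twisted_cocycles X I U A DA \<tau> e // cohomologous X I U A DA \<tau> e"

definition cohomology_class ::
  "'x diff_space \<Rightarrow> 'i set \<Rightarrow> ('i \<Rightarrow> 'x set) \<Rightarrow> ('a, 'k) monoid_scheme \<Rightarrow> 'a diff_space \<Rightarrow>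
   (int \<Rightarrow> 'a \<Rightarrow> 'a) \<Rightarrow> ('i \<Rightarrow> 'i \<Rightarrow> 'x \<Rightarrow> int) \<Rightarrow>
   ('i \<Rightarrow> 'i \<Rightarrow> 'i \<Rightarrow> 'x \<Rightarrow> 'a) \<Rightarrow> ('i \<Rightarrow> 'i \<Rightarrow> 'i \<Rightarrow> 'x \<Rightarrow> 'a) set" where
  "cohomology_class X I U A DA \<tau> e a = cohomologous X I U A DA \<tau> e `` {a}"

section \<open>Local lifts and their defect\<close>

definition local_lifts ::
  "'x diff_space \<Rightarrow> 'i set \<Rightarrow> ('i \<Rightarrow> 'x set) \<Rightarrow> 'h diff_space \<Rightarrow> ('h \<Rightarrow> 'g) \<Rightarrow>
   ('i \<Rightarrow> 'i \<Rightarrow> 'x \<Rightarrow> 'g) \<Rightarrow> ('i \<Rightarrow> 'i \<Rightarrow> 'x \<Rightarrow> 'h) \<Rightarrow> bool" where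
  "local_lifts X I U DGh q g gh \<longleftrightarrow>
     (\<forall>i\<in>I. \<forall>j\<in>I. smooth_map (subset_space X (U i \<inter> U j)) DGh (gh i j) \<and>
        (\<forall>x\<in>U i \<inter> U j. q (gh i j x) = g i j x))"

definition lift_defect ::
  "('h, 'l) monoid_scheme \<Rightarrow> (int \<Rightarrow> 'h \<Rightarrow> 'h) \<Rightarrow> ('i \<Rightarrow> 'i \<Rightarrow> 'x \<Rightarrow> int) \<Rightarrow>
   ('i \<Rightarrow> 'i \<Rightarrow> 'x \<Rightarrow> 'h) \<Rightarrow> 'i \<Rightarrow> 'i \<Rightarrow> 'i \<Rightarrow> 'x \<Rightarrow> 'h" where
  "lift_defect Gh \<sigma>h e gh i j k x =
     gh i j x \<otimes>\<^bsub>Gh\<^esub> \<sigma>h (e i j x) (gh j k x) \<otimes>\<^bsub>Gh\<^esub> inv\<^bsub>Gh\<^esub> (gh i k x)"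

text \<open>
  The same family regarded as taking values in \<open>A\<close>; this is only meaningful where
  \<^const>\<open>lift_defect\<close> lies in the image of \<open>\<iota>\<close>.
\<close>

definition lift_cochain ::
  "('a, 'k) monoid_scheme \<Rightarrow> ('a \<Rightarrow> 'h) \<Rightarrow> ('h, 'l) monoid_scheme \<Rightarrow> (int \<Rightarrow> 'h \<Rightarrow> 'h) \<Rightarrow>
   ('i \<Rightarrow> 'i \<Rightarrow> 'x \<Rightarrow> int) \<Rightarrow> ('i \<Rightarrow> 'i \<Rightarrow> 'x \<Rightarrow> 'h) \<Rightarrow> 'i \<Rightarrow> 'i \<Rightarrow> 'i \<Rightarrow> 'x \<Rightarrow> 'a" where
  "lift_cochain A \<iota> Gh \<sigma>h e gh i j k x =
     inv_into (carrier A) \<iota> (lift_defect Gh \<sigma>h e gh i j k x)"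

end

theory Submission
  imports Defs
begin

text \<open>
  Let \<open>gh\<^sub>i\<^sub>j\<close> and \<open>gh'\<^sub>i\<^sub>j\<close> be two families of lifts of \<open>g\<^sub>i\<^sub>j\<close>. They differ by a family
  \<open>b\<^sub>i\<^sub>j\<close> in the kernel of \<open>q\<close>, which is the central subgroup \<open>\<iota>(A)\<close>; as a family in \<open>A\<close> it is
  smooth because \<open>\<iota>\<close> is an induction. Substituting \<open>gh'\<^sub>i\<^sub>j = b\<^sub>i\<^sub>j gh\<^sub>i\<^sub>j\<close> in the defect
  \<open>gh'\<^sub>i\<^sub>j \<sigma>h(gh'\<^sub>j\<^sub>k) gh'\<^sub>i\<^sub>k\<^sup>-\<^sup>1\<close>, where \<open>\<sigma>h\<close> stands for the action of \<open>e\<^sub>i\<^sub>j\<close>, and moving the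
  central factors \<open>b\<^sub>i\<^sub>j\<close>, \<open>\<sigma>h(b\<^sub>j\<^sub>k)\<close> and \<open>b\<^sub>i\<^sub>k\<^sup>-\<^sup>1\<close> to one side shows that the two defects
  differ by exactly the twisted coboundary of \<open>b\<close> (\<open>lift_defect_change\<close>,
  \<open>lift_cochains_cohomologous\<close>).

  The defect takes values in \<open>\<iota>(A)\<close> because \<open>q\<close> turns it into the corresponding expression in the
  transition functions, which is trivial as these satisfy \<open>h\<^sub>i\<^sub>j h\<^sub>j\<^sub>k = h\<^sub>i\<^sub>k\<close> in the semidirect
  product (\<open>transition_functions_cocycle\<close>). It satisfies the cocycle identity because both sides
  collapse to the same product of lifts once a central factor has been moved
  (\<open>twisted_defect_cocycle\<close>). Equality of the classes then follows since being cohomologous is an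
  equivalence relation, the coboundary being multiplicative in \<open>b\<close> (\<open>equiv_cohomologous\<close>).
\<close>

section \<open>Smooth maps\<close>

lemma smooth_map_in_points: "smooth_map D E f \<Longrightarrow> x \<in> points D \<Longrightarrow> f x \<in> points E"
  by (auto simp: smooth_map_def)

lemma smooth_map_comp:
  assumes "smooth_map D E f" "smooth_map E F g"
  shows "smooth_map D F (\<lambda>x. g (f x))"
proof -
  have "plot F n U ((\<lambda>x. g (f x)) \<circ> p)" if "plot D n U p" for n U p
  proof -
    have "plot F n U (g \<circ> (f \<circ> p))"
      using assms that by (simp add: smooth_map_def)
    then show ?thesis by (simp add: o_def)
  qed
  then show ?thesis
    using assms by (auto simp: smooth_map_def image_subset_iff)
qed

lemma smooth_map_Pair:
  assumes "smooth_map Y D f" "smooth_map Y E g"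
  shows "smooth_map Y (product_space D E) (\<lambda>y. (f y, g y))"
  using assms by (auto simp: smooth_map_def product_space_def o_def)

lemma smooth_map_snd:
  assumes "smooth_map Y (product_space D E) (\<lambda>y. (f y, g y))"
  shows "smooth_map Y E g"
  using assms by (auto simp: smooth_map_def product_space_def o_def)

lemma smooth_map_subset_mono:
  assumes "smooth_map (subset_space X S) E f" "T \<subseteq> S"
  shows "smooth_map (subset_space X T) E f"
  using assms by (fastforce simp: smooth_map_def subset_space_def)

lemma points_subset_space: "points (subset_space X S) = points X \<inter> S"
  by (simp add: subset_space_def)

lemma diffeological_space_subset_space:
  assumes "diffeological_space X"
  shows "diffeological_space (subset_space X S)"
proof -
  interpret diffeological_space X by fact
  show ?thesis
  proof (unfold_locales, goal_cases)
    case (1 n U p)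
    then show ?case by (auto simp: subset_space_def dest: plot_dom)
  next
    case (2 n U p)
    then show ?case using plot_val[of n U p] by (auto simp: subset_space_def)
  next
    case (3 n U p p')
    then show ?case using plot_cong[of n U p p'] by (auto simp: subset_space_def)
  next
    case (4 n U x)
    then show ?case using plot_const[of n U x] by (auto simp: subset_space_def)
  next
    case (5 n U p)
    then have "plot X n U p"
      by (intro plot_local) (auto simp: subset_space_def, blast)
    moreover have "p ` U \<subseteq> S"
      using 5(2) by (fastforce simp: subset_space_def)
    ultimately show ?case by (simp add: subset_space_def)
  next
    case (6 n U p m V F)
    then show ?case
      using plot_compose[of n U p m V F]
      by (auto simp: subset_space_def smooth_between_def image_subset_iff)
  qed
qed

lemma smooth_map_cong:
  assumes Y: "diffeological_space Y" and E: "diffeological_space E"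
    and f: "smooth_map Y E f" and eq: "\<And>y. y \<in> points Y \<Longrightarrow> f y = f' y"
  shows "smooth_map Y E f'"
proof -
  have "plot E n U (f' \<circ> p)" if p: "plot Y n U p" for n U p
  proof (rule diffeological_space.plot_cong[OF E])
    show "plot E n U (f \<circ> p)" using f p by (simp add: smooth_map_def)
    show "(f \<circ> p) u = (f' \<circ> p) u" if "u \<in> U" for u
      using diffeological_space.plot_val[OF Y p] that eq by auto
  qed
  moreover have "f' ` points Y \<subseteq> points E"
    using f eq by (auto simp: smooth_map_def)
  ultimately show ?thesis by (simp add: smooth_map_def)
qed

text \<open>
  Smoothness into the source of an induction can be tested after the induction. This is how the
  cochains below, which are defined by applying the set-theoretic inverse of \<open>\<iota>\<close>, become smooth.
\<close>

lemma induction_map_smoothI: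
  assumes Y: "diffeological_space Y" and \<iota>: "induction_map D E \<iota>"
    and f: "f ` points Y \<subseteq> points D" and \<iota>f: "smooth_map Y E (\<lambda>y. \<iota> (f y))"
  shows "smooth_map Y D f"
proof -
  have "plot D n U (f \<circ> p)" if p: "plot Y n U p" for n U p
  proof -
    have "(f \<circ> p) ` U \<subseteq> points D"
      using diffeological_space.plot_val[OF Y p] f by auto
    moreover have "plot E n U (\<iota> \<circ> (f \<circ> p))"
      using \<iota>f p by (simp add: smooth_map_def o_def)
    ultimately show ?thesis
      using \<iota> unfolding induction_map_def by blast
  qed
  then show ?thesis using f by (simp add: smooth_map_def)
qed

context diffeological_group
begin

lemma smooth_map_mult:
  assumes "smooth_map Y D f" "smooth_map Y D f'"
  shows "smooth_map Y D (\<lambda>y. f y \<otimes> f' y)"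
  using smooth_map_comp[OF smooth_map_Pair[OF assms] smooth_mult] by simp

lemma smooth_map_inv: "smooth_map Y D f \<Longrightarrow> smooth_map Y D (\<lambda>y. inv (f y))"
  using smooth_map_comp[OF _ smooth_inv] .

lemma smooth_map_carrier: "smooth_map Y D f \<Longrightarrow> y \<in> points Y \<Longrightarrow> f y \<in> carrier G"
  using smooth_map_in_points points_carrier by metis

end

section \<open>Actions of the group of signs\<close>

lemma carrier_sign_group: "carrier sign_group = points sign_space"
  by (simp add: sign_group_def sign_space_def discrete_space_def)

lemma smooth_sign_action_hom:
  assumes "smooth_sign_action G D \<sigma>" "\<epsilon> \<in> carrier sign_group"
  shows "\<sigma> \<epsilon> \<in> hom G G"
proof -
  have "\<sigma> \<epsilon> \<in> carrier (AutoGroup G)"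
    using assms by (auto simp: smooth_sign_action_def hom_def)
  then show ?thesis by (simp add: AutoGroup_def auto_def)
qed

lemma smooth_sign_action_mult:
  assumes \<sigma>: "smooth_sign_action G D \<sigma>"
    and \<epsilon>: "\<epsilon> \<in> carrier sign_group" "\<delta> \<in> carrier sign_group" and x: "x \<in> carrier G"
  shows "\<sigma> (\<epsilon> * \<delta>) x = \<sigma> \<epsilon> (\<sigma> \<delta> x)"
proof -
  have "\<sigma> \<epsilon> \<in> carrier (AutoGroup G)" "\<sigma> \<delta> \<in> carrier (AutoGroup G)"
    using \<sigma> \<epsilon> by (auto simp: smooth_sign_action_def hom_def)
  then have "\<sigma> \<epsilon> \<in> Bij (carrier G)" "\<sigma> \<delta> \<in> Bij (carrier G)"
    by (auto simp: AutoGroup_def auto_def)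
  moreover have "\<sigma> (\<epsilon> * \<delta>) = \<sigma> \<epsilon> \<otimes>\<^bsub>AutoGroup G\<^esub> \<sigma> \<delta>"
    using \<sigma> \<epsilon> by (auto simp: smooth_sign_action_def hom_def sign_group_def)
  ultimately show ?thesis
    using x by (simp add: AutoGroup_def BijGroup_def compose_def)
qed

lemma smooth_map_sign_action:
  assumes "smooth_sign_action G D \<sigma>" "smooth_map Y sign_space e" "smooth_map Y D f"
  shows "smooth_map Y D (\<lambda>y. \<sigma> (e y) (f y))"
proof -
  have "smooth_map (product_space sign_space D) D (\<lambda>(\<epsilon>, g). \<sigma> \<epsilon> g)"
    using assms(1) by (simp add: smooth_sign_action_def)
  from smooth_map_comp[OF smooth_map_Pair[OF assms(2,3)] this] show ?thesis by simp
qed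

section \<open>Transition functions\<close>

text \<open>
  Expressing \<open>\<phi>\<^sub>k(x, 1)\<close> through \<open>\<phi>\<^sub>i\<close> directly and by way of \<open>\<phi>\<^sub>j\<close> gives two points of the same
  fibre, and \<open>\<phi>\<^sub>i\<close> is injective.
\<close>

lemma transition_functions_cocycle:
  assumes S: "diffeological_group S DS"
    and h: "transition_functions X S DS P \<pi> act I U h"
    and idx: "i \<in> I" "j \<in> I" "k \<in> I" and x: "x \<in> points X" "x \<in> U i \<inter> U j \<inter> U k"
  shows "h i j x \<otimes>\<^bsub>S\<^esub> h j k x = h i k x"
proof -
  interpret S: diffeological_group S DS by fact
  have mem: "h i' j' x \<in> carrier S" if "i' \<in> I" "j' \<in> I" "x \<in> U i' \<inter> U j'" for i' j'
  proof -
    have "smooth_map (subset_space X (U i' \<inter> U j')) DS (h i' j')"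
      using h that by (auto simp: transition_functions_def)
    then show ?thesis
      by (rule S.smooth_map_carrier) (use that x in \<open>auto simp: points_subset_space\<close>)
  qed
  obtain \<phi> where triv: "\<And>i. i \<in> I \<Longrightarrow> local_trivialisation X S DS P \<pi> act (U i) (\<phi> i)"
    and trans: "\<And>i j x s. \<lbrakk>i \<in> I; j \<in> I; x \<in> U i \<inter> U j; s \<in> carrier S\<rbrakk> \<Longrightarrow>
                  \<phi> j (x, s) = \<phi> i (x, h i j x \<otimes>\<^bsub>S\<^esub> s)"
    using h unfolding transition_functions_def by blast
  have inj: "inj_on (\<phi> i) ((points X \<inter> U i) \<times> carrier S)"
    using triv[OF idx(1)] S.points_carrier
    by (simp add: local_trivialisation_def diffeomorphism_def bij_betw_def
        product_space_def subset_space_def)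
  have hij: "h i j x \<in> carrier S" and hjk: "h j k x \<in> carrier S" and hik: "h i k x \<in> carrier S"
    using mem idx x by auto
  have "\<phi> i (x, h i j x \<otimes>\<^bsub>S\<^esub> h j k x) = \<phi> j (x, h j k x)"
    using trans[of i j x "h j k x"] idx x hjk by simp
  also have "\<dots> = \<phi> k (x, \<one>\<^bsub>S\<^esub>)"
    using trans[of j k x "\<one>\<^bsub>S\<^esub>"] idx x hjk by simp
  also have "\<dots> = \<phi> i (x, h i k x)"
    using trans[of i k x "\<one>\<^bsub>S\<^esub>"] idx x hik by simp
  finally show ?thesis
    using inj_onD[OF inj] x hij hjk hik by fastforce
qed

section \<open>Twisted cohomology classes\<close>

text \<open>
  The coboundary of \<open>b\<close> is multiplicative in \<open>b\<close>, so the trivial family, the pointwise inverse and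
  the pointwise product of families witness reflexivity, symmetry and transitivity.
\<close>

lemma equiv_cohomologous:
  fixes A :: "('a, 'k) monoid_scheme" and \<tau> :: "int \<Rightarrow> 'a \<Rightarrow> 'a"
    and e :: "'i \<Rightarrow> 'i \<Rightarrow> 'x \<Rightarrow> int"
  assumes A: "comm_group A" "diffeological_group A DA"
    and X: "diffeological_space X" and U: "\<And>i. i \<in> I \<Longrightarrow> U i \<subseteq> points X"
    and e: "\<And>i j x. \<lbrakk>i \<in> I; j \<in> I; x \<in> U i \<inter> U j\<rbrakk> \<Longrightarrow> e i j x \<in> carrier sign_group"
    and \<tau>: "\<And>\<epsilon>. \<epsilon> \<in> carrier sign_group \<Longrightarrow> \<tau> \<epsilon> \<in> hom A A"
  shows "equiv (twisted_cocycles X I U A DA \<tau> e) (cohomologous X I U A DA \<tau> e)"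
proof -
  interpret A: comm_group A by fact
  interpret DA: diffeological_group A DA by fact
  let ?Z = "twisted_cocycles X I U A DA \<tau> e" and ?R = "cohomologous X I U A DA \<tau> e"
  let ?smooth = "\<lambda>b. \<forall>i\<in>I. \<forall>j\<in>I. smooth_map (subset_space X (U i \<inter> U j)) DA (b i j)"
  let ?d = "\<lambda>b i j k x. b i j x \<otimes>\<^bsub>A\<^esub> \<tau> (e i j x) (b j k x) \<otimes>\<^bsub>A\<^esub> inv\<^bsub>A\<^esub> (b i k x)"
  have b_mem: "b i j x \<in> carrier A" if "?smooth b" "i \<in> I" "j \<in> I" "x \<in> U i \<inter> U j" for b i j x
    using DA.smooth_map_carrier[of "subset_space X (U i \<inter> U j)" "b i j" x] that U
    by (auto simp: points_subset_space)
  have a_mem: "a i j k x \<in> carrier A"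
    if "a \<in> ?Z" "i \<in> I" "j \<in> I" "k \<in> I" "x \<in> U i \<inter> U j \<inter> U k" for a i j k x
    using DA.smooth_map_carrier[of "subset_space X (U i \<inter> U j \<inter> U k)" "a i j k" x] that U
    by (auto simp: points_subset_space twisted_cocycles_def)
  have relI: "(a, a') \<in> ?R" if "a \<in> ?Z" "a' \<in> ?Z" "?smooth b"
    "\<And>i j k x. \<lbrakk>i \<in> I; j \<in> I; k \<in> I; x \<in> U i \<inter> U j \<inter> U k\<rbrakk> \<Longrightarrow>
       a' i j k x = a i j k x \<otimes>\<^bsub>A\<^esub> ?d b i j k x" for a a' b
    using that unfolding cohomologous_def by blast
  show ?thesis
  proof (rule equivI)
    show "?R \<subseteq> ?Z \<times> ?Z" by (auto simp: cohomologous_def)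
  next
    show "refl_on ?Z ?R"
    proof (rule refl_onI)
      fix a assume a: "a \<in> ?Z"
      show "(a, a) \<in> ?R"
      proof (rule relI[OF a a, of "\<lambda>_ _ _. \<one>\<^bsub>A\<^esub>"])
        have "smooth_map Y DA (\<lambda>_. \<one>\<^bsub>A\<^esub>)" if "diffeological_space Y" for Y :: "'x diff_space"
          using that DA.points_carrier DA.plot_const diffeological_space.plot_dom[OF that]
          by (auto simp: smooth_map_def o_def)
        then show "?smooth (\<lambda>_ _ _. \<one>\<^bsub>A\<^esub>)"
          using diffeological_space_subset_space[OF X] by blast
      next
        fix i j k x assume ijk: "i \<in> I" "j \<in> I" "k \<in> I" "x \<in> U i \<inter> U j \<inter> U k"
        have "\<tau> (e i j x) \<one>\<^bsub>A\<^esub> = \<one>\<^bsub>A\<^esub>"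
          using hom_one[OF \<tau>[OF e] A.is_group A.is_group] ijk by blast
        then show "a i j k x = a i j k x \<otimes>\<^bsub>A\<^esub> (\<one>\<^bsub>A\<^esub> \<otimes>\<^bsub>A\<^esub> \<tau> (e i j x) \<one>\<^bsub>A\<^esub> \<otimes>\<^bsub>A\<^esub> inv\<^bsub>A\<^esub> \<one>\<^bsub>A\<^esub>)"
          using a_mem[OF a ijk] by simp
      qed
    qed
  next
    show "sym ?R"
    proof (rule symI)
      fix a a' assume "(a, a') \<in> ?R"
      then obtain b where a: "a \<in> ?Z" "a' \<in> ?Z" and b: "?smooth b"
        and eq: "\<And>i j k x. \<lbrakk>i \<in> I; j \<in> I; k \<in> I; x \<in> U i \<inter> U j \<inter> U k\<rbrakk> \<Longrightarrow>
                   a' i j k x = a i j k x \<otimes>\<^bsub>A\<^esub> ?d b i j k x"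
        unfolding cohomologous_def by blast
      show "(a', a) \<in> ?R"
      proof (rule relI[OF a(2,1), of "\<lambda>i j x. inv\<^bsub>A\<^esub> (b i j x)"])
        show "?smooth (\<lambda>i j x. inv\<^bsub>A\<^esub> (b i j x))"
          using b DA.smooth_map_inv by blast
      next
        fix i j k x assume ijk: "i \<in> I" "j \<in> I" "k \<in> I" "x \<in> U i \<inter> U j \<inter> U k"
        have mem: "b i j x \<in> carrier A" "b j k x \<in> carrier A" "b i k x \<in> carrier A"
          using b_mem[OF b] ijk by auto
        have h: "\<tau> (e i j x) \<in> hom A A" using \<tau> e ijk by blast
        then have t: "\<tau> (e i j x) (b j k x) \<in> carrier A" using mem by (auto simp: hom_def)
        have ti: "\<tau> (e i j x) (inv\<^bsub>A\<^esub> b j k x) = inv\<^bsub>A\<^esub> \<tau> (e i j x) (b j k x)"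
          using group_hom.hom_inv[of A A "\<tau> (e i j x)"] h mem A.is_group
          by (simp add: group_hom_def group_hom_axioms_def)
        have "?d (\<lambda>i j x. inv\<^bsub>A\<^esub> (b i j x)) i j k x = inv\<^bsub>A\<^esub> (?d b i j k x)"
          using mem t ti by (simp add: A.inv_mult)
        moreover have "?d b i j k x \<in> carrier A" using mem t by simp
        ultimately show "a i j k x = a' i j k x \<otimes>\<^bsub>A\<^esub> ?d (\<lambda>i j x. inv\<^bsub>A\<^esub> (b i j x)) i j k x"
          using eq[OF ijk] a_mem[OF a(1) ijk] by (simp add: A.m_assoc)
      qed
    qed
  next
    show "trans ?R"
    proof (rule transI)
      fix a a' a'' assume "(a, a') \<in> ?R" "(a', a'') \<in> ?R"
      from this(1) obtain b where a: "a \<in> ?Z" and b: "?smooth b"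
        and eq: "\<And>i j k x. \<lbrakk>i \<in> I; j \<in> I; k \<in> I; x \<in> U i \<inter> U j \<inter> U k\<rbrakk> \<Longrightarrow>
                   a' i j k x = a i j k x \<otimes>\<^bsub>A\<^esub> ?d b i j k x"
        unfolding cohomologous_def by blast
      from \<open>(a', a'') \<in> ?R\<close> obtain b' where a'': "a'' \<in> ?Z" and b': "?smooth b'"
        and eq': "\<And>i j k x. \<lbrakk>i \<in> I; j \<in> I; k \<in> I; x \<in> U i \<inter> U j \<inter> U k\<rbrakk> \<Longrightarrow>
                   a'' i j k x = a' i j k x \<otimes>\<^bsub>A\<^esub> ?d b' i j k x"
        unfolding cohomologous_def by blast
      show "(a, a'') \<in> ?R"
      proof (rule relI[OF a a'', of "\<lambda>i j x. b i j x \<otimes>\<^bsub>A\<^esub> b' i j x"])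
        show "?smooth (\<lambda>i j x. b i j x \<otimes>\<^bsub>A\<^esub> b' i j x)"
          using b b' DA.smooth_map_mult by blast
      next
        fix i j k x assume ijk: "i \<in> I" "j \<in> I" "k \<in> I" "x \<in> U i \<inter> U j \<inter> U k"
        have mem: "b i j x \<in> carrier A" "b j k x \<in> carrier A" "b i k x \<in> carrier A"
          "b' i j x \<in> carrier A" "b' j k x \<in> carrier A" "b' i k x \<in> carrier A"
          using b_mem[OF b] b_mem[OF b'] ijk by auto
        have h: "\<tau> (e i j x) \<in> hom A A" using \<tau> e ijk by blast
        then have t: "\<tau> (e i j x) (b j k x) \<in> carrier A" "\<tau> (e i j x) (b' j k x) \<in> carrier A"
          and tm: "\<tau> (e i j x) (b j k x \<otimes>\<^bsub>A\<^esub> b' j k x) =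
             \<tau> (e i j x) (b j k x) \<otimes>\<^bsub>A\<^esub> \<tau> (e i j x) (b' j k x)"
          using mem by (auto simp: hom_def)
        have "?d (\<lambda>i j x. b i j x \<otimes>\<^bsub>A\<^esub> b' i j x) i j k x = ?d b i j k x \<otimes>\<^bsub>A\<^esub> ?d b' i j k x"
          using mem t tm by (simp add: A.inv_mult A.m_ac)
        moreover have "?d b i j k x \<in> carrier A" "?d b' i j k x \<in> carrier A" using mem t by simp_all
        ultimately show "a'' i j k x =
            a i j k x \<otimes>\<^bsub>A\<^esub> ?d (\<lambda>i j x. b i j x \<otimes>\<^bsub>A\<^esub> b' i j x) i j k x"
          using eq[OF ijk] eq'[OF ijk] a_mem[OF a ijk] by (simp add: A.m_assoc)
      qed
    qed
  qed
qed

section \<open>Two identities in a group with an endomorphism\<close>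

context group
begin

lemma inv_mult_cancel: "\<lbrakk>a \<in> carrier G; b \<in> carrier G\<rbrakk> \<Longrightarrow> inv a \<otimes> (a \<otimes> b) = b"
  by (simp add: m_assoc[symmetric])

text \<open>
  Both sides equal \<open>x s(y) s(u) w\<^sup>-\<^sup>1\<close>: on the left the two copies of \<open>r\<close> cancel, on the right the
  central factor moves past \<open>x\<close> and absorbs \<open>s(v)\<close>.
\<close>

lemma twisted_defect_cocycle:
  assumes s: "s \<in> hom G G"
    and mem: "x \<in> carrier G" "y \<in> carrier G" "u \<in> carrier G" "v \<in> carrier G"
      "r \<in> carrier G" "w \<in> carrier G"
    and central: "\<And>z. z \<in> carrier G \<Longrightarrow>
      s (y \<otimes> u \<otimes> inv v) \<otimes> z = z \<otimes> s (y \<otimes> u \<otimes> inv v)"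
  shows "(x \<otimes> s y \<otimes> inv r) \<otimes> (r \<otimes> s u \<otimes> inv w) =
         s (y \<otimes> u \<otimes> inv v) \<otimes> (x \<otimes> s v \<otimes> inv w)"
proof -
  let ?c = "y \<otimes> u \<otimes> inv v"
  have s_mem: "s z \<in> carrier G" if "z \<in> carrier G" for z using s that by (auto simp: hom_def)
  have s_mult: "s (z \<otimes> z') = s z \<otimes> s z'" if "z \<in> carrier G" "z' \<in> carrier G" for z z'
    using s that by (auto simp: hom_def)
  have c: "?c \<in> carrier G" using mem by simp
  have "s ?c \<otimes> (x \<otimes> s v \<otimes> inv w) = (s ?c \<otimes> x) \<otimes> (s v \<otimes> inv w)"
    using mem c s_mem by (simp add: m_assoc)
  also have "\<dots> = x \<otimes> (s ?c \<otimes> s v) \<otimes> inv w"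
    using mem c s_mem central[OF mem(1)] by (simp add: m_assoc)
  also have "s ?c \<otimes> s v = s (?c \<otimes> v)" using c mem s_mult by simp
  also have "?c \<otimes> v = y \<otimes> u" using mem by (simp add: m_assoc)
  also have "s (y \<otimes> u) = s y \<otimes> s u" using mem s_mult by simp
  finally show ?thesis using mem s_mem by (simp add: m_assoc inv_mult_cancel)
qed

text \<open>
  With \<open>b\<close>, \<open>c\<close>, \<open>d\<close> the changes of the three lifts \<open>x\<close>, \<open>y\<close>, \<open>r\<close>, the last factor on the right is
  the coboundary of the change. Centrality is asked of \<open>s c\<close>, the form in which \<open>c\<close> occurs.
\<close>

lemma twisted_defect_change:
  assumes s: "s \<in> hom G G"
    and mem: "x \<in> carrier G" "y \<in> carrier G" "r \<in> carrier G"
      "b \<in> carrier G" "c \<in> carrier G" "d \<in> carrier G"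
    and central: "\<And>z. z \<in> carrier G \<Longrightarrow> b \<otimes> z = z \<otimes> b"
      "\<And>z. z \<in> carrier G \<Longrightarrow> s c \<otimes> z = z \<otimes> s c"
      "\<And>z. z \<in> carrier G \<Longrightarrow> inv d \<otimes> z = z \<otimes> inv d"
  shows "(b \<otimes> x) \<otimes> s (c \<otimes> y) \<otimes> inv (d \<otimes> r) =
         (x \<otimes> s y \<otimes> inv r) \<otimes> (b \<otimes> s c \<otimes> inv d)"
proof -
  have s_mem: "s y \<in> carrier G" "s c \<in> carrier G" and s_mult: "s (c \<otimes> y) = s c \<otimes> s y"
    using s mem by (auto simp: hom_def)
  have "(b \<otimes> x) \<otimes> s (c \<otimes> y) \<otimes> inv (d \<otimes> r) = b \<otimes> ((x \<otimes> s c) \<otimes> (s y \<otimes> inv r \<otimes> inv d))"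
    using mem s_mem by (simp add: s_mult m_assoc inv_mult_group)
  also have "x \<otimes> s c = s c \<otimes> x" using central(2) mem by simp
  also have "b \<otimes> ((s c \<otimes> x) \<otimes> (s y \<otimes> inv r \<otimes> inv d)) =
      b \<otimes> (s c \<otimes> ((x \<otimes> s y \<otimes> inv r) \<otimes> inv d))"
    using mem s_mem by (simp add: m_assoc)
  also have "\<dots> = b \<otimes> (((x \<otimes> s y \<otimes> inv r) \<otimes> inv d) \<otimes> s c)"
    using mem s_mem central(2) by simp
  also have "\<dots> = (((x \<otimes> s y \<otimes> inv r) \<otimes> inv d) \<otimes> s c) \<otimes> b"
    using mem s_mem central(1) by simp
  also have "\<dots> = (x \<otimes> s y \<otimes> inv r) \<otimes> (b \<otimes> s c \<otimes> inv d)"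
    using mem s_mem central(1)[of "s c"] central(3)[of "s c \<otimes> b"] by (simp add: m_assoc)
  finally show ?thesis .
qed

end

section \<open>Equivariant central extensions\<close>

locale equivariant_central_extension =
  fixes A :: "('a, 'k) monoid_scheme" and DA :: "'a diff_space"
    and Gh :: "('h, 'l) monoid_scheme" and DGh :: "'h diff_space"
    and G :: "('g, 'm) monoid_scheme" and DG :: "'g diff_space"
    and \<iota> :: "'a \<Rightarrow> 'h" and q :: "'h \<Rightarrow> 'g"
    and \<sigma> :: "int \<Rightarrow> 'g \<Rightarrow> 'g" and \<sigma>h :: "int \<Rightarrow> 'h \<Rightarrow> 'h"
  assumes extension: "central_extension A DA Gh DGh G DG \<iota> q"
    and action: "smooth_sign_action G DG \<sigma>"
    and lifted_action: "smooth_sign_action Gh DGh \<sigma>h"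
    and equivariant:
      "\<And>\<epsilon> x. \<epsilon> \<in> carrier sign_group \<Longrightarrow> x \<in> carrier Gh \<Longrightarrow> q (\<sigma>h \<epsilon> x) = \<sigma> \<epsilon> (q x)"
begin

sublocale A: comm_group A
  using extension by (simp add: central_extension_def)

sublocale DA: diffeological_group A DA
  using extension by (simp add: central_extension_def)

sublocale Gh: diffeological_group Gh DGh
  using extension by (simp add: central_extension_def)

sublocale G: diffeological_group G DG
  using extension by (simp add: central_extension_def)

sublocale \<iota>: group_hom A Gh \<iota>
  using extension by unfold_locales (simp add: central_extension_def)

sublocale q: group_hom Gh G q
  using extension by unfold_locales (simp add: central_extension_def)

abbreviation "\<tau> \<equiv> restrict_to A \<iota> \<sigma>h"

lemma \<iota>_inj: "inj_on \<iota> (carrier A)"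
  using extension DA.points_carrier by (simp add: central_extension_def induction_map_def)

lemma \<iota>_central: "a \<in> carrier A \<Longrightarrow> x \<in> carrier Gh \<Longrightarrow> \<iota> a \<otimes>\<^bsub>Gh\<^esub> x = x \<otimes>\<^bsub>Gh\<^esub> \<iota> a"
  using extension by (simp add: central_extension_def)

lemma q_\<iota>: "a \<in> carrier A \<Longrightarrow> q (\<iota> a) = \<one>\<^bsub>G\<^esub>"
  using extension by (auto simp: central_extension_def kernel_def)

lemma kernel_lift:
  assumes "x \<in> carrier Gh" "q x = \<one>\<^bsub>G\<^esub>"
  shows "inv_into (carrier A) \<iota> x \<in> carrier A" "\<iota> (inv_into (carrier A) \<iota> x) = x"
proof -
  have "x \<in> \<iota> ` carrier A"
    using extension assms by (simp add: central_extension_def kernel_def)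
  then show "inv_into (carrier A) \<iota> x \<in> carrier A" "\<iota> (inv_into (carrier A) \<iota> x) = x"
    by (auto intro: inv_into_into f_inv_into_f)
qed

lemma smooth_into_A:
  assumes "diffeological_space Y" "\<And>y. y \<in> points Y \<Longrightarrow> f y \<in> carrier A"
    and "smooth_map Y DGh F" "\<And>y. y \<in> points Y \<Longrightarrow> \<iota> (f y) = F y"
  shows "smooth_map Y DA f"
proof (rule induction_map_smoothI[OF assms(1)])
  show "induction_map DA DGh \<iota>" using extension by (simp add: central_extension_def)
  show "f ` points Y \<subseteq> points DA" using assms(2) DA.points_carrier by auto
  show "smooth_map Y DGh (\<lambda>y. \<iota> (f y))"
    using smooth_map_cong[OF assms(1) Gh.diffeological_space_axioms assms(3)] assms(4) by simp
qed

lemma \<sigma>h_hom: "\<epsilon> \<in> carrier sign_group \<Longrightarrow> \<sigma>h \<epsilon> \<in> hom Gh Gh"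
  by (rule smooth_sign_action_hom[OF lifted_action])

lemma \<sigma>h_closed: "\<epsilon> \<in> carrier sign_group \<Longrightarrow> x \<in> carrier Gh \<Longrightarrow> \<sigma>h \<epsilon> x \<in> carrier Gh"
  using \<sigma>h_hom by (auto simp: hom_def)

text \<open>By equivariance \<open>\<sigma>h\<close> preserves the kernel of \<open>q\<close>, so that it acts on \<open>A\<close>.\<close>

lemma \<tau>_closed_\<iota>:
  assumes "\<epsilon> \<in> carrier sign_group" "a \<in> carrier A"
  shows "\<tau> \<epsilon> a \<in> carrier A" "\<iota> (\<tau> \<epsilon> a) = \<sigma>h \<epsilon> (\<iota> a)"
proof -
  have "q (\<sigma>h \<epsilon> (\<iota> a)) = \<sigma> \<epsilon> \<one>\<^bsub>G\<^esub>"
    using assms equivariant q_\<iota> by simp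
  also have "\<dots> = \<one>\<^bsub>G\<^esub>"
    by (rule hom_one[OF smooth_sign_action_hom[OF action assms(1)] G.is_group G.is_group])
  finally show "\<tau> \<epsilon> a \<in> carrier A" "\<iota> (\<tau> \<epsilon> a) = \<sigma>h \<epsilon> (\<iota> a)"
    unfolding restrict_to_def using kernel_lift \<sigma>h_closed assms by auto
qed

lemma \<tau>_hom:
  assumes \<epsilon>: "\<epsilon> \<in> carrier sign_group"
  shows "\<tau> \<epsilon> \<in> hom A A"
proof (rule homI)
  fix a b assume ab: "a \<in> carrier A" "b \<in> carrier A"
  show "\<tau> \<epsilon> a \<in> carrier A" using \<tau>_closed_\<iota> \<epsilon> ab by simp
  have "\<iota> (\<tau> \<epsilon> (a \<otimes>\<^bsub>A\<^esub> b)) = \<iota> (\<tau> \<epsilon> a \<otimes>\<^bsub>A\<^esub> \<tau> \<epsilon> b)"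
    using ab \<epsilon> \<tau>_closed_\<iota> hom_mult[OF \<sigma>h_hom[OF \<epsilon>]] by simp
  then show "\<tau> \<epsilon> (a \<otimes>\<^bsub>A\<^esub> b) = \<tau> \<epsilon> a \<otimes>\<^bsub>A\<^esub> \<tau> \<epsilon> b"
    using inj_onD[OF \<iota>_inj] ab \<epsilon> \<tau>_closed_\<iota> by simp
qed

end

section \<open>The defect of a family of lifts\<close>

text \<open>
  The last two conditions are the components of \<open>h\<^sub>i\<^sub>j h\<^sub>j\<^sub>k = h\<^sub>i\<^sub>k\<close> in the semidirect product, for
  \<open>h\<^sub>i\<^sub>j = (g\<^sub>i\<^sub>j, e\<^sub>i\<^sub>j)\<close>; this is the form in which the bundle enters the computations.
\<close>

locale twisted_transition_cocycle =
  equivariant_central_extension A DA Gh DGh G DG \<iota> q \<sigma> \<sigma>h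
  for A :: "('a, 'k) monoid_scheme" and DA :: "'a diff_space"
    and Gh :: "('h, 'l) monoid_scheme" and DGh :: "'h diff_space"
    and G :: "('g, 'm) monoid_scheme" and DG :: "'g diff_space"
    and \<iota> :: "'a \<Rightarrow> 'h" and q :: "'h \<Rightarrow> 'g"
    and \<sigma> :: "int \<Rightarrow> 'g \<Rightarrow> 'g" and \<sigma>h :: "int \<Rightarrow> 'h \<Rightarrow> 'h" +
  fixes X :: "'x diff_space" and I :: "'i set" and U :: "'i \<Rightarrow> 'x set"
    and g :: "'i \<Rightarrow> 'i \<Rightarrow> 'x \<Rightarrow> 'g" and e :: "'i \<Rightarrow> 'i \<Rightarrow> 'x \<Rightarrow> int"
  assumes X: "diffeological_space X"
    and U_points: "i \<in> I \<Longrightarrow> U i \<subseteq> points X"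
    and e_smooth:
      "\<lbrakk>i \<in> I; j \<in> I\<rbrakk> \<Longrightarrow> smooth_map (subset_space X (U i \<inter> U j)) sign_space (e i j)"
    and e_cocycle:
      "\<lbrakk>i \<in> I; j \<in> I; k \<in> I; x \<in> U i \<inter> U j \<inter> U k\<rbrakk> \<Longrightarrow> e i j x * e j k x = e i k x"
    and g_cocycle:
      "\<lbrakk>i \<in> I; j \<in> I; k \<in> I; x \<in> U i \<inter> U j \<inter> U k\<rbrakk> \<Longrightarrow>
         g i j x \<otimes>\<^bsub>G\<^esub> \<sigma> (e i j x) (g j k x) = g i k x"
begin

abbreviation "lifting \<equiv> local_lifts X I U DGh q g"
abbreviation "defect \<equiv> lift_defect Gh \<sigma>h e"
abbreviation "cochain \<equiv> lift_cochain A \<iota> Gh \<sigma>h e"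

lemma overlap_space: "diffeological_space (subset_space X W)"
  by (rule diffeological_space_subset_space[OF X])

lemma e_sign: "\<lbrakk>i \<in> I; j \<in> I; x \<in> U i \<inter> U j\<rbrakk> \<Longrightarrow> e i j x \<in> carrier sign_group"
  unfolding carrier_sign_group
  by (rule smooth_map_in_points[OF e_smooth]) (use U_points in \<open>auto simp: points_subset_space\<close>)

lemma lift_smooth:
  "\<lbrakk>lifting gh; i \<in> I; j \<in> I\<rbrakk> \<Longrightarrow> smooth_map (subset_space X (U i \<inter> U j)) DGh (gh i j)"
  by (simp add: local_lifts_def)

lemma lift_closed: "\<lbrakk>lifting gh; i \<in> I; j \<in> I; x \<in> U i \<inter> U j\<rbrakk> \<Longrightarrow> gh i j x \<in> carrier Gh"
  by (rule Gh.smooth_map_carrier[OF lift_smooth])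
    (use U_points in \<open>auto simp: points_subset_space\<close>)

lemma q_lift: "\<lbrakk>lifting gh; i \<in> I; j \<in> I; x \<in> U i \<inter> U j\<rbrakk> \<Longrightarrow> q (gh i j x) = g i j x"
  by (simp add: local_lifts_def)

lemma defect_closed:
  assumes "lifting gh" "i \<in> I" "j \<in> I" "k \<in> I" "x \<in> U i \<inter> U j \<inter> U k"
  shows "defect gh i j k x \<in> carrier Gh"
  using assms lift_closed[OF assms(1)] \<sigma>h_closed e_sign by (auto simp: lift_defect_def)

text \<open>Applying \<open>q\<close> leaves \<open>g\<^sub>i\<^sub>j \<sigma>(g\<^sub>j\<^sub>k) g\<^sub>i\<^sub>k\<^sup>-\<^sup>1 = 1\<close>; by exactness the defect then comes from \<open>A\<close>.\<close>

lemma q_defect: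
  assumes gh: "lifting gh" and ijk: "i \<in> I" "j \<in> I" "k \<in> I" "x \<in> U i \<inter> U j \<inter> U k"
  shows "q (defect gh i j k x) = \<one>\<^bsub>G\<^esub>"
proof -
  have \<epsilon>: "e i j x \<in> carrier sign_group" using e_sign ijk by blast
  have mem: "gh i j x \<in> carrier Gh" "gh j k x \<in> carrier Gh" "gh i k x \<in> carrier Gh"
    using lift_closed[OF gh] ijk by auto
  have lift: "q (gh i j x) = g i j x" "q (gh j k x) = g j k x" "q (gh i k x) = g i k x"
    using q_lift[OF gh] ijk by auto
  then have gik: "g i k x \<in> carrier G" using mem by (metis q.hom_closed)
  have "q (defect gh i j k x) = g i j x \<otimes>\<^bsub>G\<^esub> \<sigma> (e i j x) (g j k x) \<otimes>\<^bsub>G\<^esub> inv\<^bsub>G\<^esub> (g i k x)"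
    using mem \<epsilon> \<sigma>h_closed equivariant lift by (simp add: lift_defect_def)
  then show ?thesis using g_cocycle[OF ijk] gik by simp
qed

lemma cochain_\<iota>:
  assumes "lifting gh" "i \<in> I" "j \<in> I" "k \<in> I" "x \<in> U i \<inter> U j \<inter> U k"
  shows "cochain gh i j k x \<in> carrier A" "\<iota> (cochain gh i j k x) = defect gh i j k x"
  unfolding lift_cochain_def using kernel_lift[OF defect_closed q_defect] assms by auto

lemma cochain_smooth:
  assumes gh: "lifting gh" and ijk: "i \<in> I" "j \<in> I" "k \<in> I"
  shows "smooth_map (subset_space X (U i \<inter> U j \<inter> U k)) DA (cochain gh i j k)"
proof (rule smooth_into_A[OF overlap_space])
  let ?Y = "subset_space X (U i \<inter> U j \<inter> U k)"
  show "smooth_map ?Y DGh (defect gh i j k)"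
    unfolding lift_defect_def
    by (intro Gh.smooth_map_mult Gh.smooth_map_inv smooth_map_sign_action[OF lifted_action])
      (use ijk in \<open>auto intro: smooth_map_subset_mono[OF lift_smooth[OF gh]]
         smooth_map_subset_mono[OF e_smooth]\<close>)
qed (use cochain_\<iota>[OF gh ijk] in \<open>auto simp: points_subset_space\<close>)

lemma cochain_cocycle:
  assumes gh: "lifting gh"
    and idx: "i \<in> I" "j \<in> I" "k \<in> I" "l \<in> I" and x: "x \<in> U i \<inter> U j \<inter> U k \<inter> U l"
  shows "cochain gh i j k x \<otimes>\<^bsub>A\<^esub> cochain gh i k l x =
         \<tau> (e i j x) (cochain gh j k l x) \<otimes>\<^bsub>A\<^esub> cochain gh i j l x"
proof -
  let ?s = "\<sigma>h (e i j x)"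
  have \<epsilon>: "e i j x \<in> carrier sign_group" "e j k x \<in> carrier sign_group"
    using e_sign idx x by auto
  have mem: "gh i j x \<in> carrier Gh" "gh j k x \<in> carrier Gh" "gh i k x \<in> carrier Gh"
    "gh k l x \<in> carrier Gh" "gh j l x \<in> carrier Gh" "gh i l x \<in> carrier Gh"
    using lift_closed[OF gh] idx x by auto
  have c: "cochain gh i j k x \<in> carrier A" "cochain gh i k l x \<in> carrier A"
    "cochain gh j k l x \<in> carrier A" "cochain gh i j l x \<in> carrier A"
    using cochain_\<iota>(1)[OF gh] idx x by auto
  have \<iota>c: "\<iota> (cochain gh i j k x) = defect gh i j k x"
    "\<iota> (cochain gh i k l x) = defect gh i k l x"
    "\<iota> (cochain gh j k l x) = defect gh j k l x"
    "\<iota> (cochain gh i j l x) = defect gh i j l x"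
    using cochain_\<iota>(2)[OF gh] idx x by auto
  have t: "\<tau> (e i j x) (cochain gh j k l x) \<in> carrier A"
    "\<iota> (\<tau> (e i j x) (cochain gh j k l x)) = ?s (defect gh j k l x)"
    using \<tau>_closed_\<iota>[OF \<epsilon>(1) c(3)] \<iota>c by auto
  have central: "?s (defect gh j k l x) \<otimes>\<^bsub>Gh\<^esub> z = z \<otimes>\<^bsub>Gh\<^esub> ?s (defect gh j k l x)"
    if "z \<in> carrier Gh" for z
    using \<iota>_central[OF t(1) that] t(2) by simp
  \<comment> \<open>By the sign cocycle, \<open>e\<^sub>i\<^sub>k\<close> acts as \<open>e\<^sub>j\<^sub>k\<close> followed by \<open>e\<^sub>i\<^sub>j\<close>; this brings the defect over
    \<open>ikl\<close> into the form of the left-hand side in \<open>twisted_defect_cocycle\<close>.\<close>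
  have ikl: "\<sigma>h (e i k x) (gh k l x) = ?s (\<sigma>h (e j k x) (gh k l x))"
    using smooth_sign_action_mult[OF lifted_action \<epsilon> mem(4)] e_cocycle[of i j k x] idx x by simp
  have "defect gh i j k x \<otimes>\<^bsub>Gh\<^esub> defect gh i k l x =
        ?s (defect gh j k l x) \<otimes>\<^bsub>Gh\<^esub> defect gh i j l x"
    unfolding lift_defect_def ikl
    by (rule Gh.twisted_defect_cocycle)
      (use mem \<epsilon> \<sigma>h_hom \<sigma>h_closed central in \<open>auto simp: lift_defect_def\<close>)
  then have "\<iota> (cochain gh i j k x \<otimes>\<^bsub>A\<^esub> cochain gh i k l x) =
        \<iota> (\<tau> (e i j x) (cochain gh j k l x) \<otimes>\<^bsub>A\<^esub> cochain gh i j l x)"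
    using c \<iota>c t by simp
  then show ?thesis using inj_onD[OF \<iota>_inj] c t by simp
qed

lemma cochain_in_twisted_cocycles:
  assumes "lifting gh"
  shows "cochain gh \<in> twisted_cocycles X I U A DA \<tau> e"
  unfolding twisted_cocycles_def using cochain_smooth[OF assms] cochain_cocycle[OF assms] by blast

lemma lift_defect_change:
  assumes gh: "lifting gh" and ijk: "i \<in> I" "j \<in> I" "k \<in> I" "x \<in> U i \<inter> U j \<inter> U k"
    and b: "\<And>i j. \<lbrakk>i \<in> I; j \<in> I; x \<in> U i \<inter> U j\<rbrakk> \<Longrightarrow>
      b i j x \<in> carrier A \<and> gh' i j x = \<iota> (b i j x) \<otimes>\<^bsub>Gh\<^esub> gh i j x"
  shows "defect gh' i j k x = defect gh i j k x \<otimes>\<^bsub>Gh\<^esub>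
    \<iota> (b i j x \<otimes>\<^bsub>A\<^esub> \<tau> (e i j x) (b j k x) \<otimes>\<^bsub>A\<^esub> inv\<^bsub>A\<^esub> (b i k x))"
proof -
  have \<epsilon>: "e i j x \<in> carrier sign_group" using e_sign ijk by blast
  have mem: "gh i j x \<in> carrier Gh" "gh j k x \<in> carrier Gh" "gh i k x \<in> carrier Gh"
    using lift_closed[OF gh] ijk by auto
  have bm: "b i j x \<in> carrier A" "b j k x \<in> carrier A" "b i k x \<in> carrier A"
    and gh': "gh' i j x = \<iota> (b i j x) \<otimes>\<^bsub>Gh\<^esub> gh i j x"
    "gh' j k x = \<iota> (b j k x) \<otimes>\<^bsub>Gh\<^esub> gh j k x" "gh' i k x = \<iota> (b i k x) \<otimes>\<^bsub>Gh\<^esub> gh i k x"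
    using b ijk by auto
  note t = \<tau>_closed_\<iota>[OF \<epsilon> bm(2)]
  have "defect gh' i j k x = defect gh i j k x \<otimes>\<^bsub>Gh\<^esub>
      (\<iota> (b i j x) \<otimes>\<^bsub>Gh\<^esub> \<sigma>h (e i j x) (\<iota> (b j k x)) \<otimes>\<^bsub>Gh\<^esub> inv\<^bsub>Gh\<^esub> (\<iota> (b i k x)))"
    unfolding lift_defect_def gh'
  proof (rule Gh.twisted_defect_change[OF \<sigma>h_hom[OF \<epsilon>]])
    fix z assume z: "z \<in> carrier Gh"
    show "\<iota> (b i j x) \<otimes>\<^bsub>Gh\<^esub> z = z \<otimes>\<^bsub>Gh\<^esub> \<iota> (b i j x)"
      by (rule \<iota>_central[OF bm(1) z])
    show "\<sigma>h (e i j x) (\<iota> (b j k x)) \<otimes>\<^bsub>Gh\<^esub> z = z \<otimes>\<^bsub>Gh\<^esub> \<sigma>h (e i j x) (\<iota> (b j k x))"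
      using \<iota>_central[OF t(1) z] t(2) by simp
    show "inv\<^bsub>Gh\<^esub> (\<iota> (b i k x)) \<otimes>\<^bsub>Gh\<^esub> z = z \<otimes>\<^bsub>Gh\<^esub> inv\<^bsub>Gh\<^esub> (\<iota> (b i k x))"
      using \<iota>_central[OF A.inv_closed[OF bm(3)] z] bm by simp
  qed (use mem bm in auto)
  then show ?thesis using bm t by simp
qed

text \<open>
  The witness is \<open>b\<^sub>i\<^sub>j = gh'\<^sub>i\<^sub>j gh\<^sub>i\<^sub>j\<^sup>-\<^sup>1\<close>, which \<open>q\<close> maps to \<open>g\<^sub>i\<^sub>j g\<^sub>i\<^sub>j\<^sup>-\<^sup>1 = 1\<close>.
\<close>

lemma lift_cochains_cohomologous:
  assumes gh: "lifting gh" and gh': "lifting gh'"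
  shows "(cochain gh, cochain gh') \<in> cohomologous X I U A DA \<tau> e"
proof -
  define B where "B i j x = gh' i j x \<otimes>\<^bsub>Gh\<^esub> inv\<^bsub>Gh\<^esub> (gh i j x)" for i j x
  define b where "b i j x = inv_into (carrier A) \<iota> (B i j x)" for i j x
  have b: "b i j x \<in> carrier A" "\<iota> (b i j x) = B i j x"
    and change: "gh' i j x = \<iota> (b i j x) \<otimes>\<^bsub>Gh\<^esub> gh i j x"
    if ij: "i \<in> I" "j \<in> I" "x \<in> U i \<inter> U j" for i j x
  proof -
    note mem = lift_closed[OF gh ij] lift_closed[OF gh' ij]
    have gm: "g i j x \<in> carrier G" using q_lift[OF gh ij] mem by (metis q.hom_closed)
    then have "q (B i j x) = \<one>\<^bsub>G\<^esub>" and "B i j x \<in> carrier Gh"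
      unfolding B_def using mem q_lift[OF gh ij] q_lift[OF gh' ij] by simp_all
    then show "b i j x \<in> carrier A" and \<iota>b: "\<iota> (b i j x) = B i j x"
      unfolding b_def using kernel_lift by auto
    show "gh' i j x = \<iota> (b i j x) \<otimes>\<^bsub>Gh\<^esub> gh i j x"
      unfolding \<iota>b B_def using mem by (simp add: Gh.m_assoc)
  qed
  have smooth: "smooth_map (subset_space X (U i \<inter> U j)) DA (b i j)" if ij: "i \<in> I" "j \<in> I" for i j
  proof (rule smooth_into_A[OF overlap_space])
    show "smooth_map (subset_space X (U i \<inter> U j)) DGh (B i j)"
      unfolding B_def using ij gh gh'
      by (intro Gh.smooth_map_mult Gh.smooth_map_inv lift_smooth)
  qed (use b[OF ij] in \<open>auto simp: points_subset_space\<close>)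
  have "cochain gh' i j k x = cochain gh i j k x \<otimes>\<^bsub>A\<^esub>
      (b i j x \<otimes>\<^bsub>A\<^esub> \<tau> (e i j x) (b j k x) \<otimes>\<^bsub>A\<^esub> inv\<^bsub>A\<^esub> (b i k x))"
    (is "_ = _ \<otimes>\<^bsub>A\<^esub> ?d")
    if ijk: "i \<in> I" "j \<in> I" "k \<in> I" "x \<in> U i \<inter> U j \<inter> U k" for i j k x
  proof -
    note c = cochain_\<iota>[OF gh ijk] and c' = cochain_\<iota>[OF gh' ijk]
    have \<epsilon>: "e i j x \<in> carrier sign_group" using e_sign ijk by blast
    have bm: "b i j x \<in> carrier A" "b j k x \<in> carrier A" "b i k x \<in> carrier A"
      using b ijk by auto
    have d: "?d \<in> carrier A" using bm \<tau>_closed_\<iota>(1)[OF \<epsilon>] by simp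
    have "\<iota> (cochain gh' i j k x) = \<iota> (cochain gh i j k x \<otimes>\<^bsub>A\<^esub> ?d)"
      using lift_defect_change[OF gh ijk, of b gh'] b change c c' d by simp
    then show ?thesis using inj_onD[OF \<iota>_inj] c c' d by simp
  qed
  then show ?thesis
    unfolding cohomologous_def
    using cochain_in_twisted_cocycles[OF gh] cochain_in_twisted_cocycles[OF gh'] smooth by blast
qed

lemma cohomology_class_lift_cochain:
  assumes gh: "lifting gh" and gh': "lifting gh'"
  shows "cohomology_class X I U A DA \<tau> e (cochain gh) = cohomology_class X I U A DA \<tau> e (cochain gh')"
  unfolding cohomology_class_def
  by (rule equiv_class_eq[OF equiv_cohomologous lift_cochains_cohomologous[OF gh gh']])
    (use A.comm_group_axioms DA.diffeological_group_axioms X U_points e_sign \<tau>_hom in auto)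

end

section \<open>Independence of the local lifts\<close>


theorem theorem6p4:
  fixes A :: "('a, 'k) monoid_scheme" and DA :: "'a diff_space"
    and Gh :: "('h, 'l) monoid_scheme" and DGh :: "'h diff_space"
    and G :: "('g, 'm) monoid_scheme" and DG :: "'g diff_space"
    and \<iota> :: "'a \<Rightarrow> 'h" and q :: "'h \<Rightarrow> 'g"
    and \<sigma> :: "int \<Rightarrow> 'g \<Rightarrow> 'g" and \<sigma>h :: "int \<Rightarrow> 'h \<Rightarrow> 'h"
    and X :: "'x diff_space" and P :: "'p diff_space"
    and \<pi> :: "'p \<Rightarrow> 'x" and act :: "'p \<Rightarrow> 'g \<times> int \<Rightarrow> 'p"
    and I :: "'i set" and U :: "'i \<Rightarrow> 'x set"
    and g :: "'i \<Rightarrow> 'i \<Rightarrow> 'x \<Rightarrow> 'g" and e :: "'i \<Rightarrow> 'i \<Rightarrow> 'x \<Rightarrow> int"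
    and gh gh' :: "'i \<Rightarrow> 'i \<Rightarrow> 'x \<Rightarrow> 'h"
  assumes extension: "central_extension A DA Gh DGh G DG \<iota> q"
    and action: "smooth_sign_action G DG \<sigma>"
    and lifted_action: "smooth_sign_action Gh DGh \<sigma>h"
    and equivariant:
      "\<And>\<epsilon> x. \<epsilon> \<in> carrier sign_group \<Longrightarrow> x \<in> carrier Gh \<Longrightarrow> q (\<sigma>h \<epsilon> x) = \<sigma> \<epsilon> (q x)"
    and cover: "good_cover X I U"
    and principal: "principal_bundle X (semidirect_sign G \<sigma>) (semidirect_sign_space DG) P \<pi> act"
    and transition:
      "transition_functions X (semidirect_sign G \<sigma>) (semidirect_sign_space DG) P \<pi> act I U
         (\<lambda>i j x. (g i j x, e i j x))"
    and lifts: "local_lifts X I U DGh q g gh"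
    and lifts': "local_lifts X I U DGh q g gh'"
  shows "let \<tau> = restrict_to A \<iota> \<sigma>h;
             a = lift_cochain A \<iota> Gh \<sigma>h e gh;
             a' = lift_cochain A \<iota> Gh \<sigma>h e gh'
         in (\<forall>i\<in>I. \<forall>j\<in>I. \<forall>k\<in>I. \<forall>x\<in>U i \<inter> U j \<inter> U k.
               a i j k x \<in> carrier A \<and> \<iota> (a i j k x) = lift_defect Gh \<sigma>h e gh i j k x) \<and>
            a \<in> twisted_cocycles X I U A DA \<tau> e \<and>
            cohomology_class X I U A DA \<tau> e a \<in> twisted_H2 X I U A DA \<tau> e \<and>
            cohomology_class X I U A DA \<tau> e a = cohomology_class X I U A DA \<tau> e a'"
proof -
  interpret equivariant_central_extension A DA Gh DGh G DG \<iota> q \<sigma> \<sigma>h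
    by (rule equivariant_central_extension.intro) (fact extension action lifted_action equivariant)+
  let ?S = "semidirect_sign G \<sigma>" and ?DS = "semidirect_sign_space DG"
  have X: "diffeological_space X" and S: "diffeological_group ?S ?DS"
    using principal by (simp_all add: principal_bundle_def)
  have U: "U i \<subseteq> points X" if "i \<in> I" for i
    using cover that by (auto simp: good_cover_def D_open_def)
  interpret twisted_transition_cocycle A DA Gh DGh G DG \<iota> q \<sigma> \<sigma>h X I U g e
  proof (intro twisted_transition_cocycle.intro twisted_transition_cocycle_axioms.intro)
    show "equivariant_central_extension A DA Gh DGh G DG \<iota> q \<sigma> \<sigma>h"
      by (fact equivariant_central_extension_axioms)
    show "diffeological_space X" by (fact X)
    show "U i \<subseteq> points X" if "i \<in> I" for i by (rule U[OF that])
    show "smooth_map (subset_space X (U i \<inter> U j)) sign_space (e i j)" if "i \<in> I" "j \<in> I" for i j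
      using transition that
      by (auto simp: transition_functions_def semidirect_sign_space_def intro: smooth_map_snd)
    fix i j k x assume ijk: "i \<in> I" "j \<in> I" "k \<in> I" "x \<in> U i \<inter> U j \<inter> U k"
    have "x \<in> points X" using U ijk by blast
    with transition_functions_cocycle[OF S transition ijk(1-3)] ijk
    have "(g i j x, e i j x) \<otimes>\<^bsub>?S\<^esub> (g j k x, e j k x) = (g i k x, e i k x)" by blast
    then show "e i j x * e j k x = e i k x" "g i j x \<otimes>\<^bsub>G\<^esub> \<sigma> (e i j x) (g j k x) = g i k x"
      by (simp_all add: semidirect_sign_def)
  qed
  have "cohomology_class X I U A DA \<tau> e (cochain gh) \<in> twisted_H2 X I U A DA \<tau> e"
    unfolding twisted_H2_def cohomology_class_def
    by (rule quotientI[OF cochain_in_twisted_cocycles[OF lifts]])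
  then show ?thesis
    unfolding Let_def
    using cochain_\<iota>[OF lifts] cochain_in_twisted_cocycles[OF lifts]
      cohomology_class_lift_cochain[OF lifts lifts']
    by blast
qed

end
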